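(* Let $X$ be a real separable Banach space and $\gamma$ a centered Gaussian measure on $(X,\mathcal{B}(X))$ whose Cameron-Martin space $H(\gamma)$ is infinite-dimensional. Let $(h_n)_{n\ge0}$ in $H(\gamma)$ and $(h_n^* )_{n\ge0}$ in $X^*$ be the sequences produced by the iterative decomposition of $\gamma$ described in the context. Then $(h_n)_{n\ge0}=(R_\gamma h_n^* )_{n\ge0}$ is a Hilbert basis (complete orthonormal system) of $H(\gamma)$.
   Context: $X^*$ is the topological dual of $X$, $\langle x,f\rangle_{X,X^*}=f(x)$ is the duality pairing, $B_{X^*}$ is the closed unit ball of $X^*$, and $\mathcal{B}(X)$ is the Borel $\sigma$-algebra. A probability measure $\gamma$ on $(X,\mathcal{B}(X))$ is a centered Gaussian measure if for every $f\in X^*$ the pushforward $\gamma\circ f^{-1}$ is a centered (possibly degenerate) Gaussian measure on $\mathbb{R}$. Its covariance operator is $R_\gamma:X^*\to X$, $R_\gamma f=\int_X\langle x,f\rangle_{X,X^*}\,x\,\gamma(dx)$ (Bochner integral). The Cameron-Martin space $H(\gamma)$ is the Hilbertian subspace of $X$ with kernel $R_\gamma$: the unique linear subspace of $X$ equipped with a Hilbert inner product $\langle\cdot,\cdot\rangle_\gamma$ which is continuously embedded in $X$, contains $R_\gamma(X^* )$ (as a dense subset), and satisfies $\langle h,f\rangle_{X,X^*}=\langle h,R_\gamma f\rangle_\gamma$ for all $h\in H(\gamma)$, $f\in X^*$. Iterative decomposition of $\gamma$: put $\gamma_0=\gamma$. Given the centered Gaussian measure $\gamma_n$ on $X$, let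 $\lambda_n=\max_{f\in B_{X^*}}\langle R_{\gamma_n}f,f\rangle_{X,X^*}$ (the maximum is attained), choose any $f_n\in B_{X^*}$ with $\lVert f_n\rVert_{X^*}=1$ and $\langle R_{\gamma_n}f_n,f_n\rangle_{X,X^*}=\lambda_n$, define $x_n\in X$ by $R_{\gamma_n}f_n=\lambda_nx_n$, put $h_n=\sqrt{\lambda_n}\,x_n$, and let $\gamma_{n+1}$ be the image (pushforward) of $\gamma_n$ under $x\mapsto x-\langle x,f_n\rangle_{X,X^*}x_n$, i.e. the centered Gaussian measure with covariance operator $R_{\gamma_{n+1}}=R_{\gamma_n}-\lambda_n\langle x_n,\cdot\rangle_{X,X^*}x_n$. When $H(\gamma)$ is infinite-dimensional, $\lambda_n>0$ for all $n$ and the construction never stops. Define operators $P_n$ on $X$ recursively by $P_{-1}=0$ and $P_nx=\sum_{k=0}^n\langle x-P_{k-1}x,f_k\rangle_{X,X^*}x_k$, and set $x_n^*=(I-P_{n-1})^*f_n\in X^*$ (so $x_0^*=f_0$) and $h_n^*=\lambda_n^{-1/2}x_n^*$ for $n\ge0$. *)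

theory Defs
  imports "HOL-Probability.Probability"
begin

text \<open>
  The dual of a Banach space \<open>'a\<close> is the type of bounded linear functionals
  \<open>'a \<Rightarrow>\<^sub>L real\<close> with the operator norm; the pairing of \<open>x\<close> and \<open>f\<close> is
  the application \<open>blinfun_apply f x\<close>. Separability is expressed by the class
  \<open>second_countable_topology\<close>, which is equivalent to it for metric spaces.
\<close>

definition centered_gaussian_real :: "real measure \<Rightarrow> bool" where
  "centered_gaussian_real \<mu> \<longleftrightarrow>
     \<mu> = return borel 0 \<or>
     (\<exists>\<sigma>>0. \<mu> = density lborel (\<lambda>t. ennreal (normal_density 0 \<sigma> t)))"

definition centered_gaussian ::
  "'a::{banach, second_countable_topology} measure \<Rightarrow> bool" where
  "centered_gaussian \<gamma> \<longleftrightarrow>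
     prob_space \<gamma> \<and> sets \<gamma> = sets borel \<and>
     (\<forall>f::'a \<Rightarrow>\<^sub>L real. centered_gaussian_real (distr \<gamma> borel (blinfun_apply f)))"

definition cov_op ::
  "'a::{banach, second_countable_topology} measure \<Rightarrow> ('a \<Rightarrow>\<^sub>L real) \<Rightarrow> 'a" where
  "cov_op \<gamma> f = (LINT x|\<gamma>. blinfun_apply f x *\<^sub>R x)"

text \<open>
  A linear subspace \<open>H\<close> with its own inner product \<open>ip\<close>. Only the values of \<open>ip\<close>
  on \<open>H \<times> H\<close> matter.
\<close>

definition inner_product_on ::
  "'a::real_vector set \<Rightarrow> ('a \<Rightarrow> 'a \<Rightarrow> real) \<Rightarrow> bool" where
  "inner_product_on H ip \<longleftrightarrow>
     subspace H \<and>
     (\<forall>u\<in>H. \<forall>v\<in>H. ip u v = ip v u) \<and>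
     (\<forall>u\<in>H. \<forall>v\<in>H. \<forall>w\<in>H. ip (u + v) w = ip u w + ip v w) \<and>
     (\<forall>c. \<forall>u\<in>H. \<forall>v\<in>H. ip (c *\<^sub>R u) v = c * ip u v) \<and>
     (\<forall>u\<in>H. u \<noteq> 0 \<longrightarrow> 0 < ip u u)"

definition ip_norm :: "('a \<Rightarrow> 'a \<Rightarrow> real) \<Rightarrow> 'a \<Rightarrow> real" where
  "ip_norm ip u = sqrt (ip u u)"

definition complete_ip ::
  "'a::real_vector set \<Rightarrow> ('a \<Rightarrow> 'a \<Rightarrow> real) \<Rightarrow> bool" where
  "complete_ip H ip \<longleftrightarrow>
     (\<forall>s::nat \<Rightarrow> 'a. (\<forall>n. s n \<in> H) \<and>
        (\<forall>e>0. \<exists>N. \<forall>m\<ge>N. \<forall>n\<ge>N. ip_norm ip (s m - s n) < e) \<longrightarrow>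
        (\<exists>l\<in>H. (\<lambda>n. ip_norm ip (s n - l)) \<longlonglongrightarrow> 0))"

definition dense_ip ::
  "'a::real_vector set \<Rightarrow> ('a \<Rightarrow> 'a \<Rightarrow> real) \<Rightarrow> 'a set \<Rightarrow> bool" where
  "dense_ip H ip D \<longleftrightarrow>
     D \<subseteq> H \<and> (\<forall>u\<in>H. \<forall>e>0. \<exists>d\<in>D. ip_norm ip (u - d) < e)"

definition hilbertian_subspace ::
  "'a::real_normed_vector set \<Rightarrow> ('a \<Rightarrow> 'a \<Rightarrow> real) \<Rightarrow> bool" where
  "hilbertian_subspace H ip \<longleftrightarrow>
     inner_product_on H ip \<and> complete_ip H ip \<and>
     (\<exists>C. \<forall>u\<in>H. norm u \<le> C * ip_norm ip u)"

text \<open>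
  The Cameron-Martin space is the unique pair \<open>(H, ip)\<close> (up to the values of \<open>ip\<close>
  off \<open>H \<times> H\<close>) with the following property.
\<close>

definition cameron_martin_space ::
  "'a::{banach, second_countable_topology} measure \<Rightarrow> 'a set \<Rightarrow> ('a \<Rightarrow> 'a \<Rightarrow> real) \<Rightarrow> bool" where
  "cameron_martin_space \<gamma> H ip \<longleftrightarrow>
     hilbertian_subspace H ip \<and>
     dense_ip H ip (range (cov_op \<gamma>)) \<and>
     (\<forall>u\<in>H. \<forall>f. blinfun_apply f u = ip u (cov_op \<gamma> f))"

definition infinite_dimensional :: "'a::real_vector set \<Rightarrow> bool" where
  "infinite_dimensional V \<longleftrightarrow> \<not> (\<exists>B. finite B \<and> V \<subseteq> span B)"

definition hilbert_basis ::
  "'a::real_vector set \<Rightarrow> ('a \<Rightarrow> 'a \<Rightarrow> real) \<Rightarrow> (nat \<Rightarrow> 'a) \<Rightarrow> bool" where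
  "hilbert_basis H ip e \<longleftrightarrow>
     (\<forall>n. e n \<in> H) \<and>
     (\<forall>m n. ip (e m) (e n) = (if m = n then 1 else 0)) \<and>
     dense_ip H ip (span (range e))"

text \<open>
  A run of the iterative decomposition: \<open>G n\<close> is the \<open>n\<close>-th Gaussian measure,
  \<open>lam n\<close> the maximum of its covariance form over the dual unit ball, \<open>f n\<close> an
  arbitrary maximiser of norm one. The vector \<open>x n\<close> is determined by \<open>f n\<close> as long
  as \<open>lam n \<noteq> 0\<close>.
\<close>

definition iterative_decomposition ::
  "'a::{banach, second_countable_topology} measure \<Rightarrow> (nat \<Rightarrow> 'a measure) \<Rightarrow>
   (nat \<Rightarrow> real) \<Rightarrow> (nat \<Rightarrow> 'a \<Rightarrow>\<^sub>L real) \<Rightarrow> (nat \<Rightarrow> 'a) \<Rightarrow> bool" where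
  "iterative_decomposition \<gamma> G lam f x \<longleftrightarrow>
     G 0 = \<gamma> \<and>
     (\<forall>n. (\<forall>g\<in>cball 0 1. blinfun_apply g (cov_op (G n) g) \<le> lam n) \<and>
          norm (f n) = 1 \<and>
          blinfun_apply (f n) (cov_op (G n) (f n)) = lam n \<and>
          cov_op (G n) (f n) = lam n *\<^sub>R x n \<and>
          G (Suc n) = distr (G n) borel (\<lambda>y. y - blinfun_apply (f n) y *\<^sub>R x n))"

text \<open>
  The index is shifted by one: \<open>proj_op f x n\<close> is the operator usually written
  \<open>P\<^bsub>n-1\<^esub>\<close>, so that \<open>proj_op f x 0 = 0\<close> is \<open>P\<^bsub>-1\<^esub>\<close>.
\<close>

fun proj_op ::
  "(nat \<Rightarrow> 'a::real_normed_vector \<Rightarrow>\<^sub>L real) \<Rightarrow> (nat \<Rightarrow> 'a) \<Rightarrow> nat \<Rightarrow> 'a \<Rightarrow>\<^sub>L 'a" where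
  "proj_op f x n =
     (\<Sum>k\<in>{..<n}. blinfun_scaleR_left (x k) o\<^sub>L (f k o\<^sub>L (id_blinfun - proj_op f x k)))"

declare proj_op.simps [simp del]

lemma proj_op_0: "proj_op f x 0 = 0"
  by (subst proj_op.simps) simp

lemma proj_op_Suc_apply:
  "blinfun_apply (proj_op f x (Suc n)) y =
     (\<Sum>k\<le>n. blinfun_apply (f k) (y - blinfun_apply (proj_op f x k) y) *\<^sub>R x k)"
  by (subst proj_op.simps)
    (simp add: blinfun.sum_left blinfun.diff_left lessThan_Suc_atMost)

text \<open>The adjoint of an operator acts on a functional by composition.\<close>

definition x_star ::
  "(nat \<Rightarrow> 'a::real_normed_vector \<Rightarrow>\<^sub>L real) \<Rightarrow> (nat \<Rightarrow> 'a) \<Rightarrow> nat \<Rightarrow> 'a \<Rightarrow>\<^sub>L real" where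
  "x_star f x n = f n o\<^sub>L (id_blinfun - proj_op f x n)"

definition h_vec ::
  "(nat \<Rightarrow> real) \<Rightarrow> (nat \<Rightarrow> 'a::real_vector) \<Rightarrow> nat \<Rightarrow> 'a" where
  "h_vec lam x n = sqrt (lam n) *\<^sub>R x n"

definition h_star ::
  "(nat \<Rightarrow> real) \<Rightarrow> (nat \<Rightarrow> 'a::real_normed_vector \<Rightarrow>\<^sub>L real) \<Rightarrow> (nat \<Rightarrow> 'a) \<Rightarrow> nat \<Rightarrow> 'a \<Rightarrow>\<^sub>L real" where
  "h_star lam f x n = (lam n powr (-1/2)) *\<^sub>R x_star f x n"

end

theory Submission
  imports Defs
begin

text \<open>
  Write \<open>R\<^sub>n\<close> for the covariance operator of the \<open>n\<close>-th measure and \<open>h\<^sub>n\<close> for the vectors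
  \<open>sqrt (lam n) *\<^sub>R x n\<close>. Each step of the construction is a deflation of rank one, so
  \<open>R\<^sub>n g\<close> is \<open>cov_op \<gamma> g\<close> minus the sum of \<open>g(h\<^sub>k) h\<^sub>k\<close> over \<open>k < n\<close> (\<open>R_sum\<close>). By the
  reproducing property \<open>g(h\<^sub>k)\<close> is the inner product of \<open>h\<^sub>k\<close> with \<open>cov_op \<gamma> g\<close>. Hence, once
  \<open>h\<^sub>0, \<dots>, h\<^bsub>n-1\<^esub>\<close> are orthonormal, \<open>R\<^sub>n g\<close> is the component of \<open>cov_op \<gamma> g\<close> orthogonal to
  them, and \<open>h\<^sub>n\<close>, which is \<open>R\<^sub>n f\<^sub>n\<close> divided by \<open>sqrt (lam n)\<close>, is the next orthonormal
  vector. The divisor is positive because a vanishing maximum would make \<open>R\<^sub>n\<close> vanish and the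
  Cameron-Martin space finite-dimensional (\<open>lam_pos_of_orthonormal\<close>).

  Completeness amounts to smallness of the maxima. The squared norm of \<open>R\<^sub>n g\<close> is
  \<open>g(R\<^sub>n g) \<le> lam n * (norm g)\<^sup>2\<close>, so if \<open>lam n\<close> gets arbitrarily small, every \<open>cov_op \<gamma> g\<close> is
  approximated by its projections, and these vectors are dense. Since \<open>sqrt (lam n) = f\<^sub>n(h\<^sub>n)\<close>
  with \<open>f\<^sub>n\<close> of norm one, smallness expresses that the weakly null sequence \<open>h\<^sub>n\<close> tends to zero
  in norm along a subsequence, as compactness of the embedding into the Banach space predicts
  (\<open>norm_one_on_orthonormal_small\<close>). The compactness is obtained by hand: finitely many small balls carry
  half of the mass of \<open>\<gamma>\<close>, infinitely many of the \<open>f\<^sub>n\<close> nearly agree at their centres, and a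
  Gaussian variable that is small with probability one half has small variance.

  The identity of \<open>h\<^sub>n\<close> with the covariance of its functional holds because the residual
  \<open>I - P\<^bsub>n-1\<^esub>\<close> pushes \<open>\<gamma>\<close> forward to the \<open>n\<close>-th measure and maps \<open>cov_op \<gamma> g\<close> to \<open>R\<^sub>n g\<close>
  (\<open>cov_x_star\<close>).

  Integrability of \<open>y \<mapsto> f(y) y\<close>, on which all manipulations of covariances rest, is a consequence of
  the nontriviality of the Cameron-Martin space (\<open>integrable_cov\<close>).
\<close>

section \<open>Inner products on a subspace\<close>

locale ip_subspace =
  fixes H :: "'a::real_vector set" and ip :: "'a \<Rightarrow> 'a \<Rightarrow> real"
  assumes inner_product: "inner_product_on H ip"
begin

lemma subspace_H: "subspace H"
  using inner_product by (simp add: inner_product_on_def)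

lemmas H_closed = subspace_0[OF subspace_H] subspace_add[OF subspace_H]
  subspace_diff[OF subspace_H] subspace_scale[OF subspace_H] subspace_sum[OF subspace_H]

lemma ip_commute: "u \<in> H \<Longrightarrow> v \<in> H \<Longrightarrow> ip u v = ip v u"
  using inner_product by (simp add: inner_product_on_def)

lemma ip_add_left: "u \<in> H \<Longrightarrow> v \<in> H \<Longrightarrow> w \<in> H \<Longrightarrow> ip (u + v) w = ip u w + ip v w"
  using inner_product by (simp add: inner_product_on_def)

lemma ip_scale_left: "u \<in> H \<Longrightarrow> v \<in> H \<Longrightarrow> ip (c *\<^sub>R u) v = c * ip u v"
  using inner_product by (simp add: inner_product_on_def)

lemma ip_pos: "u \<in> H \<Longrightarrow> u \<noteq> 0 \<Longrightarrow> 0 < ip u u"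
  using inner_product by (simp add: inner_product_on_def)

lemma ip_diff_left: "u \<in> H \<Longrightarrow> v \<in> H \<Longrightarrow> w \<in> H \<Longrightarrow> ip (u - v) w = ip u w - ip v w"
  using ip_add_left[of u "(-1) *\<^sub>R v" w] ip_scale_left[of v w "-1"]
  by (simp add: subspace_neg[OF subspace_H])

lemma ip_zero_left: "v \<in> H \<Longrightarrow> ip 0 v = 0"
  using ip_scale_left[of 0 v 0] by (simp add: H_closed)

lemma ip_sum_left:
  "(\<And>i. i \<in> A \<Longrightarrow> u i \<in> H) \<Longrightarrow> v \<in> H \<Longrightarrow> ip (\<Sum>i\<in>A. u i) v = (\<Sum>i\<in>A. ip (u i) v)"
  by (induction A rule: infinite_finite_induct)
    (simp_all add: ip_zero_left ip_add_left H_closed)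

lemma ip_scaled_sum_left:
  assumes "\<And>i. i \<in> A \<Longrightarrow> u i \<in> H" and "v \<in> H"
  shows "ip (\<Sum>i\<in>A. c i *\<^sub>R u i) v = (\<Sum>i\<in>A. c i * ip (u i) v)"
  using assms
proof (subst ip_sum_left)
  show "(\<Sum>i\<in>A. ip (c i *\<^sub>R u i) v) = (\<Sum>i\<in>A. c i * ip (u i) v)"
    using assms by (intro sum.cong refl ip_scale_left)
qed (simp_all add: H_closed)

lemma ip_add_right: "u \<in> H \<Longrightarrow> v \<in> H \<Longrightarrow> w \<in> H \<Longrightarrow> ip w (u + v) = ip w u + ip w v"
  by (metis H_closed(2) ip_add_left ip_commute)

lemma ip_diff_right: "u \<in> H \<Longrightarrow> v \<in> H \<Longrightarrow> w \<in> H \<Longrightarrow> ip w (u - v) = ip w u - ip w v"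
  by (metis H_closed(3) ip_diff_left ip_commute)

lemma ip_scale_right: "u \<in> H \<Longrightarrow> v \<in> H \<Longrightarrow> ip u (c *\<^sub>R v) = c * ip u v"
  by (metis H_closed(4) ip_scale_left ip_commute)

lemma ip_zero_right: "v \<in> H \<Longrightarrow> ip v 0 = 0"
  using ip_zero_left[of v] ip_commute[of v 0] by (simp add: H_closed)

lemma ip_nonneg: "u \<in> H \<Longrightarrow> 0 \<le> ip u u"
  using ip_pos[of u] ip_zero_left[of 0] by (cases "u = 0") (auto simp: H_closed)

lemma ip_norm_nonneg: "u \<in> H \<Longrightarrow> 0 \<le> ip_norm ip u"
  by (simp add: ip_norm_def ip_nonneg)

lemma ip_norm_sq: "u \<in> H \<Longrightarrow> (ip_norm ip u)\<^sup>2 = ip u u"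
  by (simp add: ip_norm_def ip_nonneg)

lemma ip_Cauchy_Schwarz:
  assumes u: "u \<in> H" and v: "v \<in> H"
  shows "\<bar>ip u v\<bar> \<le> ip_norm ip u * ip_norm ip v"
proof (cases "v = 0")
  case True
  then show ?thesis using ip_zero_right[OF u] ip_zero_left[of 0] by (simp add: ip_norm_def H_closed)
next
  case False
  then have pos: "0 < ip v v" using ip_pos v by blast
  \<comment> \<open>\<open>t\<close> is the coefficient of the projection of \<open>u\<close> onto the line through \<open>v\<close>.\<close>
  define t where "t = ip u v / ip v v"
  have "0 \<le> ip (u - t *\<^sub>R v) (u - t *\<^sub>R v)"
    using u v by (intro ip_nonneg) (simp add: H_closed)
  also have "\<dots> = ip u u - 2 * t * ip u v + t * t * ip v v"
    using u v by (simp add: ip_diff_left ip_diff_right ip_scale_left ip_scale_right H_closed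
        ip_commute[of v u] algebra_simps)
  also have "\<dots> = ip u u - (ip u v)\<^sup>2 / ip v v"
    using pos by (simp add: t_def field_simps power2_eq_square)
  finally have "(ip u v)\<^sup>2 \<le> ip u u * ip v v"
    using pos by (simp add: field_simps)
  then have "sqrt ((ip u v)\<^sup>2) \<le> sqrt (ip u u * ip v v)"
    by (rule real_sqrt_le_mono)
  then show ?thesis by (simp add: ip_norm_def real_sqrt_mult)
qed

lemma ip_norm_triangle:
  assumes u: "u \<in> H" and v: "v \<in> H"
  shows "ip_norm ip (u + v) \<le> ip_norm ip u + ip_norm ip v"
proof (rule power2_le_imp_le)
  have "(ip_norm ip (u + v))\<^sup>2 = ip u u + 2 * ip u v + ip v v"
    using u v by (simp add: ip_norm_sq H_closed ip_add_left ip_add_right ip_commute[of v u])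
  also have "\<dots> \<le> ip u u + 2 * (ip_norm ip u * ip_norm ip v) + ip v v"
    using ip_Cauchy_Schwarz[OF u v] by simp
  also have "\<dots> = (ip_norm ip u + ip_norm ip v)\<^sup>2"
    using u v by (simp add: power2_sum ip_norm_sq)
  finally show "(ip_norm ip (u + v))\<^sup>2 \<le> (ip_norm ip u + ip_norm ip v)\<^sup>2" .
qed (simp add: ip_norm_nonneg u v)

text \<open>For every \<open>d\<close> in the dense set, \<open>ip v v = ip v (v - d)\<close>, and the right-hand side can be made
  smaller than \<open>ip v v\<close> by Cauchy-Schwarz unless \<open>v = 0\<close>.\<close>

lemma orthogonal_to_dense_zero:
  assumes dense: "dense_ip H ip D" and v: "v \<in> H" and orth: "\<And>d. d \<in> D \<Longrightarrow> ip v d = 0"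
  shows "v = 0"
proof (rule ccontr)
  assume "v \<noteq> 0"
  then have pos: "0 < ip v v" using ip_pos v by blast
  then have npos: "0 < ip_norm ip v" by (simp add: ip_norm_def)
  then obtain d where d: "d \<in> D" "ip_norm ip (v - d) < ip_norm ip v"
    using dense v unfolding dense_ip_def by blast
  have dH: "d \<in> H" using dense d by (auto simp: dense_ip_def)
  have "ip v v = ip v (v - d)" using v dH orth[OF d(1)] by (simp add: ip_diff_right)
  also have "\<dots> \<le> ip_norm ip v * ip_norm ip (v - d)"
    using ip_Cauchy_Schwarz[of v "v - d"] v dH by (simp add: H_closed)
  also have "\<dots> < ip_norm ip v * ip_norm ip v"
    using d npos by simp
  also have "\<dots> = ip v v" using ip_norm_sq[OF v] by (simp add: power2_eq_square)
  finally show False by simp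
qed

lemma ip_orthonormal_sum:
  fixes e :: "nat \<Rightarrow> 'a"
  assumes e: "\<And>k. k < n \<Longrightarrow> e k \<in> H"
    and on: "\<And>k l. k < n \<Longrightarrow> l < n \<Longrightarrow> ip (e k) (e l) = (if k = l then 1 else 0)"
    and l: "l < n"
  shows "ip (\<Sum>k<n. c k *\<^sub>R e k) (e l) = c l"
proof -
  have "ip (\<Sum>k<n. c k *\<^sub>R e k) (e l) = (\<Sum>k<n. c k * ip (e k) (e l))"
    using e l by (intro ip_scaled_sum_left) auto
  also have "\<dots> = (\<Sum>k<n. if k = l then c k else 0)"
    using l by (intro sum.cong) (auto simp: on)
  finally show ?thesis using l by simp
qed

lemma Bessel_tendsto_zero:
  fixes e :: "nat \<Rightarrow> 'a"
  assumes e: "\<And>k. e k \<in> H"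
    and on: "\<And>k l. ip (e k) (e l) = (if k = l then 1 else 0)"
    and u: "u \<in> H"
  shows "(\<lambda>k. ip (e k) u) \<longlonglongrightarrow> 0"
proof -
  have bound: "(\<Sum>k<n. (ip (e k) u)\<^sup>2) \<le> ip u u" for n
  proof -
    define p where "p = (\<Sum>k<n. ip (e k) u *\<^sub>R e k)"
    have pH: "p \<in> H" using e by (simp add: p_def H_closed)
    have pe: "ip p (e l) = ip (e l) u" if "l < n" for l
      unfolding p_def using that by (intro ip_orthonormal_sum) (auto simp: e on)
    have pv: "ip p v = (\<Sum>k<n. ip (e k) u * ip (e k) v)" if "v \<in> H" for v
      unfolding p_def using e that by (intro ip_scaled_sum_left)
    have pu: "ip p u = (\<Sum>k<n. (ip (e k) u)\<^sup>2)"
      using pv[OF u] by (simp add: power2_eq_square)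
    have pp: "ip p p = (\<Sum>k<n. (ip (e k) u)\<^sup>2)"
      using pv[OF pH] pe ip_commute[OF pH e] by (simp add: power2_eq_square)
    have "0 \<le> ip (u - p) (u - p)" using u pH by (simp add: ip_nonneg H_closed)
    also have "\<dots> = ip u u - (\<Sum>k<n. (ip (e k) u)\<^sup>2)"
      using u pH pu pp ip_commute[OF u pH] by (simp add: ip_diff_left ip_diff_right H_closed)
    finally show ?thesis by simp
  qed
  have "summable (\<lambda>k. (ip (e k) u)\<^sup>2)"
    by (rule summableI_nonneg_bounded[where x = "ip u u"]) (auto simp: bound)
  then have "(\<lambda>k. (ip (e k) u)\<^sup>2) \<longlonglongrightarrow> 0" by (rule summable_LIMSEQ_zero)
  then have "(\<lambda>k. sqrt ((ip (e k) u)\<^sup>2)) \<longlonglongrightarrow> sqrt 0" by (rule tendsto_real_sqrt)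
  then show ?thesis by (simp add: tendsto_rabs_zero_iff)
qed

end

section \<open>Small-ball estimates for one-dimensional centered Gaussians\<close>

text \<open>The normal density with deviation \<open>\<sigma>\<close> is at most \<open>1 / (2 * \<sigma>)\<close>, so a large variance
  forces little mass near the origin. Read backwards, mass one half on \<open>[-r, r]\<close> bounds the second
  moment: this is what turns convergence in probability into convergence in \<open>L\<^sup>2\<close>.\<close>

lemma centered_gaussian_real_second_moment_le:
  assumes G: "centered_gaussian_real \<mu>" and r: "0 \<le> r"
    and half: "1 / 2 \<le> measure \<mu> {-r..r}"
  shows "(LINT t|\<mu>. t\<^sup>2) \<le> (2 * r)\<^sup>2"
proof -
  consider "\<mu> = return borel 0"
    | \<sigma> where "\<sigma> > 0" "\<mu> = density lborel (\<lambda>t. ennreal (normal_density 0 \<sigma> t))"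
    using G by (auto simp: centered_gaussian_real_def)
  then show ?thesis
  proof cases
    case 1
    then show ?thesis by (simp add: integral_return)
  next
    case 2
    note \<sigma> = \<open>\<sigma> > 0\<close>
    have sq: "(LINT t|\<mu>. t\<^sup>2) = \<sigma>\<^sup>2"
    proof -
      have "(LINT t|\<mu>. t\<^sup>2) = (LINT t|lborel. normal_density 0 \<sigma> t * t\<^sup>2)"
        unfolding 2 by (subst integral_density) auto
      also have "\<dots> = \<sigma>\<^sup>2"
        using integral_normal_moment_even[OF \<sigma>, of 0 1] by (simp add: fact_numeral)
      finally show ?thesis .
    qed
    have dens: "normal_density 0 \<sigma> t \<le> 1 / (2 * \<sigma>)" for t
    proof -
      have "(2 * \<sigma>)\<^sup>2 \<le> 2 * pi * \<sigma>\<^sup>2"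
        using pi_ge_two by (simp add: power_mult_distrib mult_right_mono)
      then have "2 * \<sigma> \<le> sqrt (2 * pi * \<sigma>\<^sup>2)" by (rule real_le_rsqrt)
      then have "1 / sqrt (2 * pi * \<sigma>\<^sup>2) \<le> 1 / (2 * \<sigma>)" using \<sigma> by (intro divide_left_mono) auto
      moreover have "exp (- (t - 0)\<^sup>2 / (2 * \<sigma>\<^sup>2)) \<le> 1" by simp
      ultimately show ?thesis unfolding normal_density_def
        using mult_mono[of "1 / sqrt (2 * pi * \<sigma>\<^sup>2)" "1 / (2 * \<sigma>)"
            "exp (- (t - 0)\<^sup>2 / (2 * \<sigma>\<^sup>2))" 1] \<sigma> by simp
    qed
    have "emeasure \<mu> {-r..r} = (\<integral>\<^sup>+t. ennreal (normal_density 0 \<sigma> t) * indicator {-r..r} t \<partial>lborel)"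
      unfolding 2 by (subst emeasure_density) auto
    also have "\<dots> \<le> (\<integral>\<^sup>+t. ennreal (1 / (2 * \<sigma>)) * indicator {-r..r} t \<partial>lborel)"
      using dens by (intro nn_integral_mono mult_right_mono ennreal_leI) auto
    also have "\<dots> = ennreal (1 / (2 * \<sigma>)) * ennreal (2 * r)"
      using r by (subst nn_integral_cmult_indicator) auto
    also have "\<dots> = ennreal (r / \<sigma>)"
      using r \<sigma> by (simp add: ennreal_mult[symmetric])
    finally have "measure \<mu> {-r..r} \<le> r / \<sigma>"
      using r \<sigma> by (simp add: measure_def enn2real_leI)
    with half have "1 / 2 \<le> r / \<sigma>" by (rule order_trans)
    then have "\<sigma> \<le> 2 * r" using \<sigma> by (simp add: field_simps)
    then show ?thesis unfolding sq using \<sigma> by (intro power_mono) auto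
  qed
qed

section \<open>Approximation by finitely many points\<close>

text \<open>By separability, finitely many small balls carry half of a probability measure. They serve
  as a finite net on which functionals of norm one are almost determined.\<close>

lemma finite_net_half_measure:
  fixes \<gamma> :: "'a::{metric_space, second_countable_topology} measure"
  assumes "prob_space \<gamma>" and sets: "sets \<gamma> = sets borel" and eps: "0 < \<epsilon>"
  shows "\<exists>D. finite D \<and> 1 / 2 \<le> measure \<gamma> (\<Union>d\<in>D. ball d \<epsilon>)"
proof -
  interpret prob_space \<gamma> by fact
  obtain D :: "'a set" where D: "countable D" "\<And>X. open X \<Longrightarrow> X \<noteq> {} \<Longrightarrow> \<exists>d\<in>D. d \<in> X"
    using countable_dense_setE by blast
  have "D \<noteq> {}" using D(2)[of UNIV] by auto
  define d where "d = from_nat_into D"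
  have range_d: "range d = D" unfolding d_def using \<open>D \<noteq> {}\<close> D(1) by (rule range_from_nat_into)
  define A where "A n = (\<Union>i<n. ball (d i) \<epsilon>)" for n
  have "(\<lambda>n. prob (A n)) \<longlonglongrightarrow> prob (\<Union>n. A n)"
  proof (rule finite_Lim_measure_incseq)
    show "range A \<subseteq> sets \<gamma>" by (auto simp: A_def sets)
    show "incseq A" by (force simp: A_def incseq_def)
  qed
  moreover have "(\<Union>n. A n) = UNIV"
  proof (intro equalityI subsetI UNIV_I)
    fix y :: 'a
    obtain z where z: "z \<in> D" "z \<in> ball y \<epsilon>" using D(2)[of "ball y \<epsilon>"] eps by auto
    then obtain i where "d i = z" using range_d by auto
    then have "y \<in> A (Suc i)" using z by (auto simp: A_def dist_commute)
    then show "y \<in> (\<Union>n. A n)" by blast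
  qed
  moreover have "prob UNIV = 1"
    using prob_space sets_eq_imp_space_eq[OF sets] by simp
  ultimately have "(\<lambda>n. prob (A n)) \<longlonglongrightarrow> 1" by simp
  then have "\<forall>\<^sub>F n in sequentially. 1 / 2 < prob (A n)" by (rule order_tendstoD) simp
  then obtain n where "1 / 2 < prob (A n)" by (auto simp: eventually_sequentially)
  then show ?thesis
    by (intro exI[of _ "d ` {..<n}"]) (simp add: A_def image_image)
qed

lemma convergent_subsequence_on_finite_set:
  fixes f :: "nat \<Rightarrow> 'b \<Rightarrow> real"
  assumes "finite D" and "\<And>d. d \<in> D \<Longrightarrow> bounded (range (\<lambda>n. f n d))"
  shows "\<exists>r. strict_mono (r :: nat \<Rightarrow> nat) \<and> (\<forall>d\<in>D. convergent (\<lambda>n. f (r n) d))"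
  using assms
proof (induction D rule: finite_induct)
  case empty
  show ?case by (rule exI[of _ id]) (auto simp: strict_mono_def)
next
  case (insert d D)
  then obtain r where r: "strict_mono r" "\<And>d. d \<in> D \<Longrightarrow> convergent (\<lambda>n. f (r n) d)"
    by auto
  have "bounded (range (\<lambda>n. f (r n) d))"
    using insert.prems[of d, OF insertI1] by (rule bounded_subset) auto
  then obtain l s where s: "strict_mono s" "((\<lambda>n. f (r n) d) \<circ> s) \<longlonglongrightarrow> l"
    using bounded_imp_convergent_subsequence by blast
  have "convergent (\<lambda>n. f (r (s n)) c)" if "c \<in> insert d D" for c
  proof (cases "c = d")
    case True
    then show ?thesis using s(2) by (auto simp: convergent_def o_def)
  next
    case False
    then show ?thesis
      using convergent_subseq_convergent[OF r(2) s(1), of c] that by (simp add: o_def)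
  qed
  moreover have "strict_mono (\<lambda>n. r (s n))" using strict_mono_o[OF r(1) s(1)] by (simp add: o_def)
  ultimately show ?case by (intro exI[of _ "\<lambda>n. r (s n)"]) auto
qed

lemma clustering_on_finite_set:
  fixes f :: "nat \<Rightarrow> 'b \<Rightarrow> real"
  assumes D: "finite D" and bd: "\<And>d. d \<in> D \<Longrightarrow> bounded (range (\<lambda>n. f n d))" and eps: "0 < \<epsilon>"
  shows "\<exists>r m. strict_mono (r :: nat \<Rightarrow> nat) \<and>
    (\<forall>\<^sub>F n in sequentially. \<forall>d\<in>D. \<bar>f (r n) d - f m d\<bar> < \<epsilon>)"
proof -
  obtain r where r: "strict_mono (r :: nat \<Rightarrow> nat)" "\<And>d. d \<in> D \<Longrightarrow> convergent (\<lambda>n. f (r n) d)"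
    using convergent_subsequence_on_finite_set[of D f, OF D bd] by blast
  have "\<forall>\<^sub>F n in sequentially. \<forall>d\<in>D. \<bar>f (r n) d - lim (\<lambda>n. f (r n) d)\<bar> < \<epsilon> / 2"
  proof (rule eventually_ball_finite[OF D], rule ballI)
    fix d assume "d \<in> D"
    then have "(\<lambda>n. f (r n) d) \<longlonglongrightarrow> lim (\<lambda>n. f (r n) d)"
      using r(2) by (simp add: convergent_LIMSEQ_iff)
    from tendstoD[OF this, of "\<epsilon> / 2"]
    show "\<forall>\<^sub>F n in sequentially. \<bar>f (r n) d - lim (\<lambda>n. f (r n) d)\<bar> < \<epsilon> / 2"
      using eps by (simp add: dist_real_def)
  qed
  then obtain N where
    N: "\<And>n d. n \<ge> N \<Longrightarrow> d \<in> D \<Longrightarrow> \<bar>f (r n) d - lim (\<lambda>n. f (r n) d)\<bar> < \<epsilon> / 2"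
    by (auto simp: eventually_sequentially)
  have "\<bar>f (r n) d - f (r N) d\<bar> < \<epsilon>" if "n \<ge> N" "d \<in> D" for n d
    using N[of n d] N[of N d] that by linarith
  then have "\<forall>\<^sub>F n in sequentially. \<forall>d\<in>D. \<bar>f (r n) d - f (r N) d\<bar> < \<epsilon>"
    by (auto simp: eventually_sequentially)
  with r(1) show ?thesis by blast
qed

section \<open>The covariance operator\<close>

locale cameron_martin =
  fixes \<gamma> :: "'a::{banach, second_countable_topology} measure"
    and H :: "'a set" and ip :: "'a \<Rightarrow> 'a \<Rightarrow> real"
  assumes gaussian: "centered_gaussian \<gamma>"
    and cm: "cameron_martin_space \<gamma> H ip"
    and inf_dim: "infinite_dimensional H"

sublocale cameron_martin \<subseteq> ip_subspace H ip
  using cm by unfold_locales (simp add: cameron_martin_space_def hilbertian_subspace_def)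

context cameron_martin
begin

lemma prob: "prob_space \<gamma>" and sets_gamma: "sets \<gamma> = sets borel"
  using gaussian by (auto simp: centered_gaussian_def)

lemma blinfun_measurable [measurable]:
  "blinfun_apply (T :: 'a \<Rightarrow>\<^sub>L 'b::real_normed_vector) \<in> borel_measurable \<gamma>"
  unfolding measurable_cong_sets[OF sets_gamma refl]
  by (intro borel_measurable_continuous_onI linear_continuous_on blinfun.bounded_linear_right)

lemma cov_in_H: "cov_op \<gamma> f \<in> H"
  and cov_dense: "dense_ip H ip (range (cov_op \<gamma>))"
  and reproducing: "u \<in> H \<Longrightarrow> blinfun_apply f u = ip u (cov_op \<gamma> f)"
  using cm by (auto simp: cameron_martin_space_def dense_ip_def)

lemma H_eqI:
  fixes u v :: 'a
  assumes "u \<in> H" "v \<in> H" and "\<And>g :: 'a \<Rightarrow>\<^sub>L real. blinfun_apply g u = blinfun_apply g v"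
  shows "u = v"
proof -
  have "u - v = 0"
    by (rule orthogonal_to_dense_zero[OF cov_dense])
      (use assms in \<open>auto simp: H_closed reproducing[symmetric] blinfun.diff_right\<close>)
  then show ?thesis by simp
qed

text \<open>Bochner integrability of \<open>y \<mapsto> f(y) y\<close> usually comes from Fernique's theorem. Here the
  nontriviality of the Cameron-Martin space suffices. The functionals \<open>f\<close> with
  integrable \<open>y \<mapsto> f(y) y\<close> form a subspace, and any functional outside it has covariance \<open>0\<close>
  by the default value of the integral, hence vanishes on \<open>H\<close>. If the subspace were proper, every
  functional would be a difference of two functionals outside it, so \<open>H\<close> would be trivial.\<close>

lemma integrable_cov: "integrable \<gamma> (\<lambda>y. blinfun_apply f y *\<^sub>R y)"
proof (rule ccontr)
  let ?I = "\<lambda>f::'a \<Rightarrow>\<^sub>L real. integrable \<gamma> (\<lambda>y. blinfun_apply f y *\<^sub>R y)"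
  assume bad: "\<not> ?I f"
  have van: "blinfun_apply g u = 0" if "\<not> ?I g" "u \<in> H" for g u
    using reproducing[OF that(2), of g] not_integrable_integral_eq[OF that(1)] ip_zero_right that(2)
    by (simp add: cov_op_def)
  have all: "blinfun_apply g u = 0" if u: "u \<in> H" for g :: "'a \<Rightarrow>\<^sub>L real" and u
  proof (cases "?I g")
    case True
    have "\<not> ?I (g + f)"
    proof
      assume "?I (g + f)"
      then have "integrable \<gamma> (\<lambda>y. blinfun_apply (g + f) y *\<^sub>R y - blinfun_apply g y *\<^sub>R y)"
        using True by (rule Bochner_Integration.integrable_diff)
      then show False using bad by (simp add: blinfun.add_left algebra_simps)
    qed
    from van[OF this u] van[OF bad u] show ?thesis by (simp add: blinfun.add_left)
  qed (rule van[OF _ u])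
  have "H \<subseteq> {0}"
  proof
    fix u assume u: "u \<in> H"
    then show "u \<in> {0}" using H_eqI[OF u H_closed(1)] all[OF u] by (simp add: blinfun.zero_right)
  qed
  then have "H \<subseteq> span {}" by simp
  with inf_dim show False unfolding infinite_dimensional_def by blast
qed

lemma cov_diff: "cov_op \<gamma> (f - g) = cov_op \<gamma> f - cov_op \<gamma> g"
  unfolding cov_op_def
  by (simp add: blinfun.diff_left scaleR_diff_left Bochner_Integration.integral_diff integrable_cov)

lemma cov_scale: "cov_op \<gamma> (c *\<^sub>R f) = c *\<^sub>R cov_op \<gamma> f"
  unfolding cov_op_def
  by (simp add: blinfun.scaleR_left integral_scaleR_right flip: scaleR_scaleR)

lemma cov_ip: "blinfun_apply g (cov_op \<gamma> f) = ip (cov_op \<gamma> f) (cov_op \<gamma> g)"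
  by (rule reproducing[OF cov_in_H])

lemma cov_sym: "blinfun_apply g (cov_op \<gamma> f) = blinfun_apply f (cov_op \<gamma> g)"
  by (simp add: cov_ip ip_commute cov_in_H)

lemma cov_second_moment:
  "blinfun_apply f (cov_op \<gamma> f) = (LINT t|distr \<gamma> borel (blinfun_apply f). t\<^sup>2)"
proof -
  have "blinfun_apply f (cov_op \<gamma> f) = (LINT y|\<gamma>. blinfun_apply f (blinfun_apply f y *\<^sub>R y))"
    unfolding cov_op_def
    by (rule integral_bounded_linear[OF blinfun.bounded_linear_right integrable_cov, symmetric])
  also have "\<dots> = (LINT y|\<gamma>. (blinfun_apply f y)\<^sup>2)"
    by (simp add: blinfun.scaleR_right power2_eq_square)
  also have "\<dots> = (LINT t|distr \<gamma> borel (blinfun_apply f). t\<^sup>2)"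
    by (subst integral_distr) auto
  finally show ?thesis .
qed

lemma cov_distr:
  "cov_op (distr \<gamma> borel (blinfun_apply S)) g = blinfun_apply S (cov_op \<gamma> (g o\<^sub>L S))"
proof -
  have "cov_op (distr \<gamma> borel (blinfun_apply S)) g =
      (LINT y|\<gamma>. blinfun_apply g (blinfun_apply S y) *\<^sub>R blinfun_apply S y)"
    unfolding cov_op_def
    by (subst integral_distr)
      (auto intro!: borel_measurable_continuous_onI continuous_intros)
  also have "\<dots> = (LINT y|\<gamma>. blinfun_apply S (blinfun_apply (g o\<^sub>L S) y *\<^sub>R y))"
    by (simp add: blinfun.scaleR_right)
  also have "\<dots> = blinfun_apply S (cov_op \<gamma> (g o\<^sub>L S))"
    unfolding cov_op_def
    by (rule integral_bounded_linear[OF blinfun.bounded_linear_right integrable_cov])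
  finally show ?thesis .
qed

text \<open>The bound \<open>6 * \<epsilon>\<close> is twice the radius \<open>3 * \<epsilon>\<close>: functionals of norm one that
  differ by at most \<open>\<epsilon>\<close> at the centre of a ball of radius \<open>\<epsilon>\<close> differ by at most \<open>3 * \<epsilon>\<close> on it.\<close>

lemma cov_norm_le_of_close_on_net:
  assumes D: "finite D" "1 / 2 \<le> measure \<gamma> (\<Union>d\<in>D. ball d \<epsilon>)" and eps: "0 < \<epsilon>"
    and f: "norm f \<le> 1" and g: "norm g \<le> 1"
    and close: "\<And>d. d \<in> D \<Longrightarrow> \<bar>blinfun_apply f d - blinfun_apply g d\<bar> < \<epsilon>"
  shows "ip_norm ip (cov_op \<gamma> (f - g)) \<le> 6 * \<epsilon>"
proof -
  interpret prob_space \<gamma> by (rule prob)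
  have sp: "space \<gamma> = UNIV" using sets_eq_imp_space_eq[OF sets_gamma] by simp
  let ?\<mu> = "distr \<gamma> borel (blinfun_apply (f - g))"
  have "(\<Union>d\<in>D. ball d \<epsilon>) \<subseteq> blinfun_apply (f - g) -` {-(3 * \<epsilon>)..3 * \<epsilon>}"
  proof
    fix y assume "y \<in> (\<Union>d\<in>D. ball d \<epsilon>)"
    then obtain d where d: "d \<in> D" "norm (y - d) < \<epsilon>" by (auto simp: dist_norm norm_minus_commute)
    have le: "\<bar>blinfun_apply k (y - d)\<bar> \<le> \<epsilon>" if "norm k \<le> 1" for k :: "'a \<Rightarrow>\<^sub>L real"
    proof -
      have "\<bar>blinfun_apply k (y - d)\<bar> \<le> norm k * norm (y - d)"
        using norm_blinfun[of k "y - d"] by simp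
      also have "\<dots> \<le> 1 * \<epsilon>" using that d(2) by (intro mult_mono) auto
      finally show ?thesis by simp
    qed
    show "y \<in> blinfun_apply (f - g) -` {-(3 * \<epsilon>)..3 * \<epsilon>}"
      using le[OF f] le[OF g] close[OF d(1)]
      by (auto simp: blinfun.diff_left blinfun.diff_right)
  qed
  then have "measure \<gamma> (\<Union>d\<in>D. ball d \<epsilon>) \<le> measure \<gamma> (blinfun_apply (f - g) -` {-(3 * \<epsilon>)..3 * \<epsilon>})"
    using measurable_sets[OF blinfun_measurable, of "{-(3 * \<epsilon>)..3 * \<epsilon>}" "f - g"] sp
    by (intro finite_measure_mono) auto
  also have "\<dots> = measure ?\<mu> {-(3 * \<epsilon>)..3 * \<epsilon>}"
    by (subst measure_distr) (auto simp: sp)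
  finally have "1 / 2 \<le> measure ?\<mu> {-(3 * \<epsilon>)..3 * \<epsilon>}" using D(2) by simp
  moreover have "centered_gaussian_real ?\<mu>" using gaussian by (simp add: centered_gaussian_def)
  ultimately have "(LINT t|?\<mu>. t\<^sup>2) \<le> (2 * (3 * \<epsilon>))\<^sup>2"
    using eps by (intro centered_gaussian_real_second_moment_le) auto
  then have "(ip_norm ip (cov_op \<gamma> (f - g)))\<^sup>2 \<le> (6 * \<epsilon>)\<^sup>2"
    by (simp add: ip_norm_sq cov_in_H cov_ip[symmetric] cov_second_moment)
  then show ?thesis by (rule power2_le_imp_le) (use eps in simp)
qed

text \<open>This is compactness of the embedding of \<open>H\<close> into the Banach space, applied to a weakly null
  sequence. Along a subsequence the functionals \<open>f n\<close> cluster on a finite net, so that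
  \<open>cov_op \<gamma> (f n)\<close> stays close to one fixed vector of \<open>H\<close>, against which the orthonormal
  sequence tends to \<open>0\<close>.\<close>

lemma norm_one_on_orthonormal_small:
  fixes f :: "nat \<Rightarrow> 'a \<Rightarrow>\<^sub>L real" and e :: "nat \<Rightarrow> 'a"
  assumes e: "\<And>k. e k \<in> H" and on: "\<And>k l. ip (e k) (e l) = (if k = l then 1 else 0)"
    and f: "\<And>n. norm (f n) \<le> 1" and eps: "0 < \<epsilon>"
  shows "\<exists>n. \<bar>blinfun_apply (f n) (e n)\<bar> < \<epsilon>"
proof -
  define \<delta> where "\<delta> = \<epsilon> / 7"
  have \<delta>: "0 < \<delta>" using eps by (simp add: \<delta>_def)
  obtain D where D: "finite D" "1 / 2 \<le> measure \<gamma> (\<Union>d\<in>D. ball d \<delta>)"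
    using finite_net_half_measure[OF prob sets_gamma \<delta>] by blast
  have "bounded (range (\<lambda>n. blinfun_apply (f n) d))" for d
  proof (rule boundedI)
    fix t assume "t \<in> range (\<lambda>n. blinfun_apply (f n) d)"
    then obtain n where "t = blinfun_apply (f n) d" by auto
    then show "norm t \<le> norm d"
      using norm_blinfun[of "f n" d] mult_right_mono[OF f[of n], of "norm d"] by simp
  qed
  from clustering_on_finite_set[of D "\<lambda>n d. blinfun_apply (f n) d", OF D(1) this \<delta>]
  obtain r m where r: "strict_mono (r :: nat \<Rightarrow> nat)"
    and cl: "\<forall>\<^sub>F n in sequentially. \<forall>d\<in>D. \<bar>blinfun_apply (f (r n)) d - blinfun_apply (f m) d\<bar> < \<delta>"
    by blast
  have "(\<lambda>n. ip (e (r n)) (cov_op \<gamma> (f m))) \<longlonglongrightarrow> 0"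
    using LIMSEQ_subseq_LIMSEQ[OF Bessel_tendsto_zero[of e, OF e on cov_in_H] r] by (simp add: o_def)
  from tendstoD[OF this \<delta>]
  have "\<forall>\<^sub>F n in sequentially. \<bar>ip (e (r n)) (cov_op \<gamma> (f m))\<bar> < \<delta>" by simp
  from eventually_happens'[OF sequentially_bot eventually_conj[OF cl this]]
  obtain n where n: "\<forall>d\<in>D. \<bar>blinfun_apply (f (r n)) d - blinfun_apply (f m) d\<bar> < \<delta>"
    and small: "\<bar>ip (e (r n)) (cov_op \<gamma> (f m))\<bar> < \<delta>" by blast
  have "ip_norm ip (e (r n)) = 1" by (simp add: ip_norm_def on)
  then have "\<bar>ip (e (r n)) (cov_op \<gamma> (f (r n) - f m))\<bar> \<le> 6 * \<delta>"
    using ip_Cauchy_Schwarz[OF e cov_in_H, of "r n" "f (r n) - f m"]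
      cov_norm_le_of_close_on_net[OF D \<delta> f f, of "r n" m] n by simp
  moreover have "blinfun_apply (f (r n)) (e (r n)) =
      ip (e (r n)) (cov_op \<gamma> (f m)) + ip (e (r n)) (cov_op \<gamma> (f (r n) - f m))"
    by (simp add: reproducing e cov_diff ip_diff_right cov_in_H)
  ultimately have "\<bar>blinfun_apply (f (r n)) (e (r n))\<bar> < \<epsilon>"
    using small by (simp add: \<delta>_def)
  then show ?thesis by blast
qed

end

section \<open>The iterative decomposition\<close>

lemma proj_op_Suc: "blinfun_apply (proj_op f x (Suc n)) y =
   blinfun_apply (proj_op f x n) y + blinfun_apply (x_star f x n) y *\<^sub>R x n"
proof -
  have "blinfun_apply (proj_op f x n) y =
      (\<Sum>k<n. blinfun_apply (f k) (y - blinfun_apply (proj_op f x k) y) *\<^sub>R x k)"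
    by (subst proj_op.simps) (simp add: blinfun.sum_left blinfun.diff_left)
  then show ?thesis
    by (simp add: proj_op_Suc_apply lessThan_Suc_atMost[symmetric] x_star_def blinfun.diff_left)
qed

locale cameron_martin_decomposition = cameron_martin \<gamma> H ip
  for \<gamma> :: "'a::{banach, second_countable_topology} measure"
    and H :: "'a set" and ip :: "'a \<Rightarrow> 'a \<Rightarrow> real" +
  fixes G :: "nat \<Rightarrow> 'a measure" and lam :: "nat \<Rightarrow> real"
    and f :: "nat \<Rightarrow> 'a \<Rightarrow>\<^sub>L real" and x :: "nat \<Rightarrow> 'a"
  assumes decomp: "iterative_decomposition \<gamma> G lam f x"
begin

definition residual :: "nat \<Rightarrow> 'a \<Rightarrow>\<^sub>L 'a" where
  "residual n = id_blinfun - proj_op f x n"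

abbreviation h :: "nat \<Rightarrow> 'a" where "h \<equiv> h_vec lam x"

abbreviation R :: "nat \<Rightarrow> ('a \<Rightarrow>\<^sub>L real) \<Rightarrow> 'a" where "R n \<equiv> cov_op (G n)"

lemma G_0: "G 0 = \<gamma>"
  and norm_f: "norm (f n) = 1"
  and f_R_f: "blinfun_apply (f n) (R n (f n)) = lam n"
  and R_f: "R n (f n) = lam n *\<^sub>R x n"
  and G_Suc: "G (Suc n) = distr (G n) borel (\<lambda>y. y - blinfun_apply (f n) y *\<^sub>R x n)"
  using decomp unfolding iterative_decomposition_def by blast+

lemma lam_max: "norm g \<le> 1 \<Longrightarrow> blinfun_apply g (R n g) \<le> lam n"
  using decomp by (simp add: iterative_decomposition_def)

lemma x_star_residual: "x_star f x n = f n o\<^sub>L residual n"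
  by (simp add: x_star_def residual_def)

lemma residual_Suc:
  "blinfun_apply (residual (Suc n)) y =
     blinfun_apply (residual n) y - blinfun_apply (f n) (blinfun_apply (residual n) y) *\<^sub>R x n"
  by (simp add: residual_def proj_op_Suc x_star_def blinfun.diff_left)

lemma residual_sum:
  "blinfun_apply (residual n) y = y - (\<Sum>k<n. blinfun_apply (x_star f x k) y *\<^sub>R x k)"
proof (induction n)
  case 0
  show ?case by (simp add: residual_def proj_op_0)
next
  case (Suc n)
  then show ?case by (simp add: residual_Suc x_star_residual)
qed

lemma G_residual: "G n = distr \<gamma> borel (blinfun_apply (residual n))"
proof (induction n)
  case 0
  have "blinfun_apply (residual 0) = (\<lambda>y. y)" by (auto simp: residual_sum)
  then show ?case using distr_id2[OF sets_gamma[symmetric]] by (simp add: G_0)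
next
  case (Suc n)
  have "(\<lambda>y. y - blinfun_apply (f n) y *\<^sub>R x n) \<in> borel_measurable borel"
    by (intro borel_measurable_continuous_onI continuous_intros)
  then show ?case
    unfolding G_Suc Suc by (subst distr_distr) (auto simp: o_def fun_eq_iff residual_Suc intro!: arg_cong[where f = "distr \<gamma> borel"])
qed

lemma R_residual: "R n g = blinfun_apply (residual n) (cov_op \<gamma> (g o\<^sub>L residual n))"
  unfolding G_residual by (rule cov_distr)

lemma R_sym: "blinfun_apply g (R n k) = blinfun_apply k (R n g)"
  using cov_sym[of "g o\<^sub>L residual n" "k o\<^sub>L residual n"] by (simp add: R_residual)

lemma lam_nonneg: "0 \<le> lam n"
  using lam_max[of 0 n] by simp

text \<open>Subtracting the part of the measure seen by \<open>f n\<close> is a deflation of rank one.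
  The formula also covers \<open>lam n = 0\<close>, where \<open>h n = 0\<close>.\<close>

lemma R_Suc: "R (Suc n) g = R n g - blinfun_apply g (h n) *\<^sub>R h n"
proof -
  have comp: "g o\<^sub>L residual (Suc n) =
      (g o\<^sub>L residual n) - blinfun_apply g (x n) *\<^sub>R (f n o\<^sub>L residual n)"
    by (rule blinfun_eqI)
      (simp add: residual_Suc blinfun.diff_left blinfun.diff_right blinfun.scaleR_left
        blinfun.scaleR_right)
  let ?T = "\<lambda>y. y - blinfun_apply (f n) y *\<^sub>R x n"
  have "R (Suc n) g = ?T (R n g - blinfun_apply g (x n) *\<^sub>R R n (f n))"
    by (simp add: R_residual[of "Suc n"] comp residual_Suc cov_diff cov_scale
        R_residual[of n] blinfun.diff_right blinfun.scaleR_right algebra_simps)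
  also have "\<dots> = R n g - blinfun_apply (f n) (R n g) *\<^sub>R x n
      - blinfun_apply g (x n) *\<^sub>R (R n (f n) - blinfun_apply (f n) (R n (f n)) *\<^sub>R x n)"
    by (simp add: blinfun.diff_right blinfun.scaleR_right algebra_simps)
  \<comment> \<open>The last bracket vanishes because \<open>f n (R n (f n)) = lam n\<close>; this avoids dividing by
    \<open>lam n\<close>, which is not yet known to be positive.\<close>
  also have "\<dots> = R n g - blinfun_apply g (R n (f n)) *\<^sub>R x n"
    by (simp add: R_f[symmetric] f_R_f R_sym[of "f n" n g])
  also have "\<dots> = R n g - blinfun_apply g (h n) *\<^sub>R h n"
    using lam_nonneg[of n] by (simp add: R_f h_vec_def blinfun.scaleR_right algebra_simps)
  finally show ?thesis .
qed

lemma R_sum: "R n g = cov_op \<gamma> g - (\<Sum>k<n. blinfun_apply g (h k) *\<^sub>R h k)"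
  by (induction n) (simp_all add: G_0 R_Suc)

text \<open>Once \<open>h 0, \<dots>, h (n - 1)\<close> are orthonormal, \<open>R n g\<close> is the component of \<open>cov_op \<gamma> g\<close>
  orthogonal to them, so \<open>g (R n g)\<close> is the squared norm of that component.\<close>

lemma R_orthogonal_component:
  assumes hH: "\<forall>k<n. h k \<in> H"
    and on: "\<forall>k<n. \<forall>l<n. ip (h k) (h l) = (if k = l then 1 else 0)"
  shows "R n g \<in> H"
    and "l < n \<Longrightarrow> ip (R n g) (h l) = 0"
    and "ip (R n g) (R n g) = blinfun_apply g (R n g)"
proof -
  let ?p = "\<Sum>k<n. blinfun_apply g (h k) *\<^sub>R h k"
  have pH: "?p \<in> H" using hH by (intro H_closed) auto
  show RH: "R n g \<in> H" unfolding R_sum using pH by (simp add: H_closed cov_in_H)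
  show orth: "ip (R n g) (h l) = 0" if "l < n" for l
  proof -
    have hl: "h l \<in> H" using hH that by blast
    have "ip ?p (h l) = blinfun_apply g (h l)"
      by (rule ip_orthonormal_sum) (use hH on that in auto)
    then show ?thesis
      unfolding R_sum using pH hl
      by (simp add: ip_diff_left cov_in_H reproducing ip_commute[OF hl cov_in_H])
  qed
  have "ip ?p (R n g) = (\<Sum>k<n. blinfun_apply g (h k) * ip (h k) (R n g))"
    using hH RH by (intro ip_scaled_sum_left) auto
  also have "\<dots> = 0"
    using orth hH RH by (intro sum.neutral) (simp add: ip_commute)
  finally have "ip ?p (R n g) = 0" .
  moreover have "ip (R n g) (R n g) = ip (cov_op \<gamma> g) (R n g) - ip ?p (R n g)"
    using ip_diff_left[OF cov_in_H pH RH, of g] by (simp add: R_sum)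
  ultimately show "ip (R n g) (R n g) = blinfun_apply g (R n g)"
    using reproducing[OF RH, of g] ip_commute[OF RH cov_in_H, of g] by simp
qed

text \<open>If the maximum vanished, then so would \<open>R n\<close>, and every element of \<open>H\<close> would equal its
  projection onto the span of \<open>h 0, \<dots>, h (n - 1)\<close>.\<close>

lemma lam_pos_of_orthonormal:
  assumes hH: "\<forall>k<n. h k \<in> H"
    and on: "\<forall>k<n. \<forall>l<n. ip (h k) (h l) = (if k = l then 1 else 0)"
  shows "0 < lam n"
proof (rule ccontr)
  assume "\<not> 0 < lam n"
  then have l0: "lam n = 0" using lam_nonneg[of n] by simp
  note oc = R_orthogonal_component[OF hH on]
  have ball: "R n g = 0" if "norm g \<le> 1" for g
  proof (rule ccontr)
    assume "R n g \<noteq> 0"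
    then have "0 < ip (R n g) (R n g)" by (intro ip_pos oc(1))
    then show False using lam_max[OF that, of n] oc(3)[where g = g] l0 by simp
  qed
  have R0: "R n g = 0" for g
  proof (cases "g = 0")
    case True then show ?thesis using ball by simp
  next
    case False
    have "R n ((1 / norm g) *\<^sub>R g) = (1 / norm g) *\<^sub>R R n g"
      by (simp add: R_sum cov_scale blinfun.scaleR_left scaleR_diff_right scaleR_sum_right)
    moreover have "R n ((1 / norm g) *\<^sub>R g) = 0" using False by (intro ball) simp
    ultimately show ?thesis using False by simp
  qed
  have "H \<subseteq> span (h ` {..<n})"
  proof
    fix u assume u: "u \<in> H"
    let ?p = "\<Sum>k<n. ip u (h k) *\<^sub>R h k"
    have pH: "?p \<in> H" using hH by (intro H_closed) auto
    have "u = ?p"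
    proof (rule H_eqI[OF u pH])
      fix g
      have "blinfun_apply g u = ip u (\<Sum>k<n. blinfun_apply g (h k) *\<^sub>R h k)"
        using reproducing[OF u, of g] R0[of g] by (simp add: R_sum)
      also have "\<dots> = ip (\<Sum>k<n. blinfun_apply g (h k) *\<^sub>R h k) u"
        using u hH by (intro ip_commute H_closed) auto
      also have "\<dots> = (\<Sum>k<n. blinfun_apply g (h k) * ip (h k) u)"
        using u hH by (intro ip_scaled_sum_left) auto
      also have "\<dots> = blinfun_apply g ?p"
        unfolding blinfun.sum_right blinfun.scaleR_right
        using u hH by (intro sum.cong) (auto simp: ip_commute)
      finally show "blinfun_apply g u = blinfun_apply g ?p" .
    qed
    also have "?p \<in> span (h ` {..<n})"
      by (intro span_sum span_scale span_base) auto
    finally show "u \<in> span (h ` {..<n})" .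
  qed
  then show False using inf_dim unfolding infinite_dimensional_def by blast
qed

lemma h_eq_R: "0 < lam n \<Longrightarrow> h n = (1 / sqrt (lam n)) *\<^sub>R R n (f n)"
  by (simp add: h_vec_def R_f real_div_sqrt)

lemma h_orthonormal_below:
  "(\<forall>k<n. h k \<in> H) \<and> (\<forall>k<n. \<forall>l<n. ip (h k) (h l) = (if k = l then 1 else 0))"
proof (induction n)
  case 0
  show ?case by simp
next
  case (Suc n)
  then have hH: "\<forall>k<n. h k \<in> H"
    and on: "\<forall>k<n. \<forall>l<n. ip (h k) (h l) = (if k = l then 1 else 0)" by auto
  note oc = R_orthogonal_component[OF hH on]
  have pos: "0 < lam n" using hH on by (rule lam_pos_of_orthonormal)
  note hn = h_eq_R[OF pos]
  have hnH: "h n \<in> H" unfolding hn by (intro H_closed oc(1))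
  have "ip (h n) (h n) = 1"
    using pos oc(1) oc(3)[where g = "f n"] f_R_f[of n] unfolding hn
    by (simp add: ip_scale_left ip_scale_right H_closed)
  moreover have nk: "ip (h n) (h k) = 0" if "k < n" for k
    using oc(1) oc(2)[OF that] hH that unfolding hn by (simp add: ip_scale_left)
  moreover have "ip (h k) (h n) = 0" if "k < n" for k
    using nk[OF that] ip_commute[OF hnH] hH that by metis
  ultimately show ?case using hH on hnH by (auto simp: less_Suc_eq)
qed

lemma h_in_H: "h n \<in> H"
  using h_orthonormal_below[of "Suc n"] by simp

lemma h_orthonormal: "ip (h m) (h n) = (if m = n then 1 else 0)"
  using h_orthonormal_below[of "Suc (max m n)"] by simp

lemma lam_pos: "0 < lam n"
  by (rule lam_pos_of_orthonormal) (auto simp: h_in_H h_orthonormal)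

lemma R_in_H: "R n g \<in> H"
  and R_ip_self: "ip (R n g) (R n g) = blinfun_apply g (R n g)"
  using R_orthogonal_component(1,3)[of n g] by (simp_all add: h_in_H h_orthonormal)

text \<open>Since \<open>f n\<close> takes the value \<open>sqrt (lam n)\<close> at \<open>h n\<close>, the maxima become arbitrarily small.\<close>

lemma lam_small: "0 < e \<Longrightarrow> \<exists>n. lam n < e"
proof -
  assume e: "0 < e"
  have val: "blinfun_apply (f n) (h n) = sqrt (lam n)" for n
    using lam_pos[of n] f_R_f[of n]
    by (simp add: h_eq_R blinfun.scaleR_right real_div_sqrt)
  obtain n where "\<bar>blinfun_apply (f n) (h n)\<bar> < sqrt e"
    using norm_one_on_orthonormal_small[of h f "sqrt e"] e
    by (auto simp: h_in_H h_orthonormal norm_f)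
  then have "lam n < e" using lam_pos[of n] by (simp add: val)
  then show ?thesis by blast
qed

text \<open>For \<open>k < n\<close> the functional \<open>x_star f x k\<close> already represents \<open>lam k *\<^sub>R x k\<close>, so
  \<open>residual n\<close> and the projection orthogonal to \<open>h 0, \<dots>, h (n - 1)\<close> agree on the range of the
  covariance operator. Symmetry of \<open>R n\<close> then moves the residual onto \<open>f n\<close>.\<close>

lemma cov_x_star: "cov_op \<gamma> (x_star f x n) = lam n *\<^sub>R x n"
proof (induction n rule: less_induct)
  case (less n)
  have res: "blinfun_apply (residual n) (cov_op \<gamma> g) = R n g" for g
  proof -
    have "blinfun_apply (x_star f x k) (cov_op \<gamma> g) *\<^sub>R x k = blinfun_apply g (h k) *\<^sub>R h k"
      if "k < n" for k
    proof -
      have "blinfun_apply (x_star f x k) (cov_op \<gamma> g) = blinfun_apply g (cov_op \<gamma> (x_star f x k))"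
        by (rule cov_sym)
      also have "\<dots> = lam k * blinfun_apply g (x k)"
        unfolding less[OF that] by (simp add: blinfun.scaleR_right)
      finally show ?thesis
        using lam_nonneg[of k] by (simp add: h_vec_def blinfun.scaleR_right)
    qed
    then show ?thesis by (simp add: residual_sum R_sum)
  qed
  have "cov_op \<gamma> (x_star f x n) = R n (f n)"
  proof (rule H_eqI[OF cov_in_H R_in_H])
    fix g
    have "blinfun_apply g (cov_op \<gamma> (x_star f x n)) = blinfun_apply (x_star f x n) (cov_op \<gamma> g)"
      by (rule cov_sym)
    also have "\<dots> = blinfun_apply (f n) (R n g)" by (simp add: x_star_residual res)
    also have "\<dots> = blinfun_apply g (R n (f n))" by (rule R_sym)
    finally show "blinfun_apply g (cov_op \<gamma> (x_star f x n)) = blinfun_apply g (R n (f n))" .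
  qed
  then show ?case by (simp add: R_f)
qed

lemma h_eq_cov_h_star: "h n = cov_op \<gamma> (h_star lam f x n)"
proof -
  have "lam n powr (-1/2) * lam n = sqrt (lam n)"
    using lam_pos[of n] by (simp add: powr_minus_divide powr_half_sqrt real_div_sqrt)
  then show ?thesis by (simp add: h_star_def cov_scale cov_x_star h_vec_def)
qed

lemma h_span_dense: "dense_ip H ip (span (range h))"
  unfolding dense_ip_def
proof (intro conjI ballI allI impI)
  show "span (range h) \<subseteq> H"
    by (rule span_minimal[OF _ subspace_H]) (auto simp: h_in_H)
next
  fix u and e :: real assume u: "u \<in> H" and e: "0 < e"
  obtain g where g: "ip_norm ip (u - cov_op \<gamma> g) < e / 2"
    using cov_dense u e half_gt_zero[OF e] unfolding dense_ip_def by blast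
  define c where "c = norm g + 1"
  have c: "0 < c" by (simp add: c_def add_nonneg_pos)
  obtain n where n: "lam n < (e / (2 * c))\<^sup>2"
    using lam_small[of "(e / (2 * c))\<^sup>2"] e c by auto
  let ?d = "\<Sum>k<n. blinfun_apply g (h k) *\<^sub>R h k"
  have dH: "?d \<in> H" by (intro H_closed h_in_H)
  \<comment> \<open>Scaling \<open>g\<close> by \<open>1 / c\<close> puts it into the unit ball, where \<open>lam n\<close> bounds the quadratic form.\<close>
  have "blinfun_apply ((1 / c) *\<^sub>R g) (R n ((1 / c) *\<^sub>R g)) = (1 / c)\<^sup>2 * blinfun_apply g (R n g)"
    by (simp add: R_sum cov_scale blinfun.scaleR_left blinfun.scaleR_right blinfun.diff_right
        blinfun.sum_right sum_distrib_left power2_eq_square algebra_simps)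
  moreover have "norm ((1 / c) *\<^sub>R g) \<le> 1" using c by (simp add: c_def)
  ultimately have "(1 / c)\<^sup>2 * blinfun_apply g (R n g) \<le> lam n" using lam_max by metis
  then have "blinfun_apply g (R n g) \<le> c\<^sup>2 * lam n"
    using c by (simp add: field_simps)
  also have "\<dots> < c\<^sup>2 * (e / (2 * c))\<^sup>2" using n c by simp
  also have "\<dots> = (e / 2)\<^sup>2" using c by (simp add: field_simps)
  finally have "(ip_norm ip (R n g))\<^sup>2 < (e / 2)\<^sup>2"
    by (simp add: ip_norm_sq R_in_H R_ip_self)
  then have Rn: "ip_norm ip (R n g) < e / 2" by (rule power2_less_imp_less) (use e in simp)
  have split: "u - ?d = (u - cov_op \<gamma> g) + R n g" by (simp add: R_sum)
  have "ip_norm ip (u - ?d) \<le> ip_norm ip (u - cov_op \<gamma> g) + ip_norm ip (R n g)"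
    unfolding split using u by (intro ip_norm_triangle H_closed cov_in_H R_in_H)
  then have "ip_norm ip (u - ?d) < e" using g Rn by simp
  moreover have "?d \<in> span (range h)" by (intro span_sum span_scale span_base) auto
  ultimately show "\<exists>d\<in>span (range h). ip_norm ip (u - d) < e" by blast
qed

end

theorem theorem3p6:
  fixes \<gamma> :: "'a::{banach, second_countable_topology} measure"
    and H :: "'a set" and ip :: "'a \<Rightarrow> 'a \<Rightarrow> real"
    and G :: "nat \<Rightarrow> 'a measure" and lam :: "nat \<Rightarrow> real"
    and f :: "nat \<Rightarrow> 'a \<Rightarrow>\<^sub>L real" and x :: "nat \<Rightarrow> 'a"
  assumes "centered_gaussian \<gamma>"
    and "cameron_martin_space \<gamma> H ip"
    and "infinite_dimensional H"
    and "iterative_decomposition \<gamma> G lam f x"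
  shows "(\<forall>n. h_vec lam x n = cov_op \<gamma> (h_star lam f x n)) \<and>
         hilbert_basis H ip (h_vec lam x)"
proof -
  interpret cameron_martin_decomposition \<gamma> H ip G lam f x
    using assms by unfold_locales
  show ?thesis
    using h_eq_cov_h_star h_in_H h_orthonormal h_span_dense by (simp add: hilbert_basis_def)
qed

end
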